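(* Let $N \ge 2$ and consider the simple exclusion process with rates $\rho_x = 1$ for all $x$ on the star graph with $N$ vertices and center $0$, that is, the graph with vertex set $\{0, 1, \ldots, N-1\}$ whose edges are exactly the pairs $(0, x)$ with $x = 1, \ldots, N-1$. Then, for all $0 < K \le N$, $$ p_K(0) = \frac{(N-1)K}{(N-1)K + (N-K)} $$ and $$ p_K(x) = \left(\frac{K}{N-1}\right) \frac{(N-1)K - (K-1)}{(N-1)K + (N-K)} \quad \text{for } x \ne 0. $$
   Context: Let $\mathscr{G} = (\mathscr{V},\mathscr{E})$ be a finite connected graph on $N$ vertices; $\deg(x)$ is the degree of $x$. A configuration is a map $\eta : \mathscr{V} \to \{0,1\}$, where $\eta(x) = 1$ means that $x$ is occupied by a particle and $\eta(x) = 0$ that $x$ is empty. A configuration $\eta$ is identified with the subset $\{x \in \mathscr{V} : \eta(x) = 1\}$ of $\mathscr{V}$. For $x, y \in \mathscr{V}$, $\tau_{x,y}\eta$ is the configuration obtained from $\eta$ by exchanging the states at $x$ and $y$. The simple exclusion process with rates $(\rho_x)$ is the continuous-time Markov chain $(\eta_t)_{t\ge 0}$ on $\{0,1\}^{\mathscr{V}}$ that jumps from $\eta$ to $\xi \ne \eta$ at rate $q(\eta,\xi) = \rho_x/\deg(x)$ if $\xi = \tau_{x,y}\eta$ for some edge $(x,y) \in \mathscr{E}$ with $\eta(x) = 1$ (hence $\eta(y) = 0$), and at rate $q(\eta,\xi) = 0$ otherwise. In words, the particle at $x$, if there is one, chooses a neighbor of $x$ uniformly at random at rate $\rho_x$ and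 jumps there if and only if it is empty. For $0 < K \le N$ and $x \in \mathscr{V}$, $$ p_K(x) = \lim_{t \to \infty} P(x \in \eta_t \mid \operatorname{card}(\eta_0) = K); $$ these limits exist and depend on the initial configuration only through its number $K$ of particles. *)

theory Defs
  imports "HOL-Probability.Probability" "HOL-Combinatorics.Transposition"
begin

text \<open>
  A transition function on a finite state space: a stochastic semigroup whose right derivative
  at time 0 has the off-diagonal entries \<open>q\<close>. The diagonal entries are then determined
  by the row sums, so \<open>q i i\<close> is irrelevant.
\<close>

definition transition_function ::
  "'s set \<Rightarrow> ('s \<Rightarrow> 's \<Rightarrow> real) \<Rightarrow> (real \<Rightarrow> 's \<Rightarrow> 's \<Rightarrow> real) \<Rightarrow> bool" where
  "transition_function S q P \<longleftrightarrow>
     (\<forall>t\<ge>0. \<forall>i\<in>S. \<forall>j\<in>S. 0 \<le> P t i j) \<and>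
     (\<forall>t\<ge>0. \<forall>i\<in>S. (\<Sum>j\<in>S. P t i j) = 1) \<and>
     (\<forall>i\<in>S. \<forall>j\<in>S. P 0 i j = (if i = j then 1 else 0)) \<and>
     (\<forall>s\<ge>0. \<forall>t\<ge>0. \<forall>i\<in>S. \<forall>j\<in>S. P (s + t) i j = (\<Sum>k\<in>S. P s i k * P t k j)) \<and>
     (\<forall>i\<in>S. \<forall>j\<in>S. i \<noteq> j \<longrightarrow>
        ((\<lambda>t. P t i j) has_real_derivative q i j) (at 0 within {0..}))"

text \<open>
  Only the values of \<open>X t\<close> for \<open>t \<ge> 0\<close> matter. The initial distribution is arbitrary.
\<close>

locale continuous_time_markov_chain = prob_space M
  for M :: "'w measure"
  and S :: "'s set"
  and q :: "'s \<Rightarrow> 's \<Rightarrow> real"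
  and X :: "real \<Rightarrow> 'w \<Rightarrow> 's" +
  assumes finite_states: "finite S"
  and measurable_state: "\<And>t. 0 \<le> t \<Longrightarrow> X t \<in> measurable M (count_space S)"
  and right_continuous_paths:
    "AE \<omega> in M. \<forall>t\<ge>0. \<forall>\<^sub>F s in at_right t. X s \<omega> = X t \<omega>"
  and markov_property:
    "\<exists>P. transition_function S q P \<and>
       (\<forall>n (t :: nat \<Rightarrow> real) (i :: nat \<Rightarrow> 's).
          0 \<le> t 0 \<longrightarrow> (\<forall>k\<le>n. t k \<le> t (Suc k)) \<longrightarrow> (\<forall>k\<le>Suc n. i k \<in> S) \<longrightarrow>
          \<P>(\<omega> in M. \<forall>k\<le>n. X (t k) \<omega> = i k) > 0 \<longrightarrow>
          \<P>(\<omega> in M. X (t (Suc n)) \<omega> = i (Suc n) \<bar> \<forall>k\<le>n. X (t k) \<omega> = i k)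
            = P (t (Suc n) - t n) (i n) (i (Suc n)))"

text \<open>
  A graph is given by its vertex set \<open>V\<close> and its set \<open>E\<close> of two-element edges; a configuration
  is the set of its occupied vertices.
\<close>

definition vertex_degree :: "'v set \<Rightarrow> 'v set set \<Rightarrow> 'v \<Rightarrow> nat" where
  "vertex_degree V E x = card {y \<in> V. {x, y} \<in> E}"

definition exchange :: "'v \<Rightarrow> 'v \<Rightarrow> 'v set \<Rightarrow> 'v set" where
  "exchange x y \<eta> = {z. Transposition.transpose x y z \<in> \<eta>}"

text \<open>
  The sum below has at most one term, because \<open>x\<close> is the only element of \<open>\<eta> - \<xi>\<close> and
  \<open>y\<close> the only element of \<open>\<xi> - \<eta>\<close>.
\<close>

definition exclusion_rate ::
  "'v set \<Rightarrow> 'v set set \<Rightarrow> ('v \<Rightarrow> real) \<Rightarrow> 'v set \<Rightarrow> 'v set \<Rightarrow> real" where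
  "exclusion_rate V E \<rho> \<eta> \<xi> =
     (if \<xi> = \<eta> then 0
      else \<Sum>(x, y) \<in> {(x, y) \<in> V \<times> V. {x, y} \<in> E \<and> x \<in> \<eta> \<and> \<xi> = exchange x y \<eta>}.
             \<rho> x / real (vertex_degree V E x))"

lemma exclusion_rate_exchange:
  assumes "x \<in> V" "y \<in> V" "{x, y} \<in> E" "x \<in> \<eta>" "y \<notin> \<eta>"
  shows "exclusion_rate V E \<rho> \<eta> (exchange x y \<eta>) = \<rho> x / real (vertex_degree V E x)"
proof -
  have ex: "exchange a b \<eta> = (if b \<in> \<eta> then \<eta> else insert b (\<eta> - {a}))" if "a \<in> \<eta>" for a b
    using that by (auto simp: exchange_def Transposition.transpose_def split: if_splits)
  have uniq: "a = x \<and> b = y" if "a \<in> \<eta>" "exchange x y \<eta> = exchange a b \<eta>" for a b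
  proof -
    have "insert y (\<eta> - {x}) = (if b \<in> \<eta> then \<eta> else insert b (\<eta> - {a}))"
      using that assms ex by simp
    with that(1) assms(4,5) show ?thesis
      by (auto split: if_splits)
  qed
  have "{(a, b) \<in> V \<times> V. {a, b} \<in> E \<and> a \<in> \<eta> \<and> exchange x y \<eta> = exchange a b \<eta>} = {(x, y)}"
    using assms by (auto dest: uniq)
  moreover have "exchange x y \<eta> \<noteq> \<eta>"
    using assms ex by auto
  ultimately show ?thesis
    by (simp add: exclusion_rate_def)
qed

definition simple_exclusion_process ::
  "'w measure \<Rightarrow> 'v set \<Rightarrow> 'v set set \<Rightarrow> ('v \<Rightarrow> real) \<Rightarrow> (real \<Rightarrow> 'w \<Rightarrow> 'v set) \<Rightarrow> bool" where
  "simple_exclusion_process M V E \<rho> X \<longleftrightarrow>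
     continuous_time_markov_chain M (Pow V) (exclusion_rate V E \<rho>) X"

definition star_edges :: "nat \<Rightarrow> nat set set" where
  "star_edges N = (\<lambda>x. {0, x}) ` {1..<N}"

end

theory Submission
  imports Defs
begin

text \<open>
  On the star the occupation of the centre is, by itself, a two-state Markov chain. With \<open>K\<close>
  particles in total, an empty centre is filled at rate \<open>K\<close>, because each of the \<open>K\<close> leaf particles
  jumps to it at rate 1. An occupied centre is vacated at rate \<open>(N - K) / (N - 1)\<close>, the proportion
  of empty leaves. Writing \<open>s = K + (N - K) / (N - 1)\<close>, its occupation probability relaxes
  exponentially fast to \<open>K / s\<close>, which is the claimed limit at the centre.

  For a leaf \<open>x\<close>, let \<open>a\<close>, \<open>b\<close>, \<open>c\<close> be the probabilities that the centre, the leaf, and both are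
  occupied. On configurations with \<open>K\<close> particles the generator maps the span of these indicators
  and the constants into itself, so that
  \<open>a' = K - s a\<close>, \<open>b' = a / (N - 1) - b + \<kappa> c\<close>, \<open>c' = (K - 1) b - (s - 1) c\<close>
  with \<open>\<kappa> = (N - 2) / (N - 1)\<close> (lemmas \<open>star_generator_center\<close>, \<open>star_generator_leaf\<close>,
  \<open>star_generator_pair\<close>).
  The matrix acting on \<open>(b, c)\<close> has trace \<open>-s\<close> and determinant 1, and \<open>s \<ge> 2\<close>; its eigenvalues are
  therefore \<open>-\<mu>\<close> and \<open>-\<nu>\<close> with \<open>\<mu>, \<nu> > 0\<close>, \<open>\<mu> + \<nu> = s\<close>, \<open>\<mu> \<nu> = 1\<close>. These may coincide, so
  the system is brought to triangular rather than diagonal form: \<open>u = (\<mu> - 1) b + \<kappa> c\<close> satisfies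
  \<open>u' = (\<mu> - 1) a / (N - 1) - \<nu> u\<close> and \<open>b' = u + a / (N - 1) - \<mu> b\<close>. Each equation is a stable
  scalar linear one whose forcing term converges, and three applications of
  \<open>mean_relaxation\<close> give the limits of \<open>a\<close>, \<open>u\<close> and \<open>b\<close> in turn.

  The differential equations are instances of Kolmogorov's forward equation, which
  \<open>forward_equation\<close> derives from the semigroup law and the derivative at time 0. That equation
  also shows that the number of particles is conserved. Finally, conditioning on the number of
  particles at time 0 averages over initial configurations for which all limits agree
  (\<open>conditional_limit\<close>).
\<close>

section \<open>Scalar linear equations with convergent forcing\<close>

text \<open>
  The derivative of \<open>exp (r t) u t\<close> is \<open>exp (r t) v t\<close>, and dividing by the derivative of
  \<open>exp (r t)\<close> leaves \<open>v t / r\<close>; l'Hopital's rule does the rest.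
\<close>

lemma linear_relaxation:
  fixes u v :: "real \<Rightarrow> real"
  assumes r: "0 < r"
    and deriv: "\<And>t. 0 < t \<Longrightarrow> (u has_real_derivative v t - r * u t) (at t)"
    and lim: "(v \<longlongrightarrow> c) at_top"
  shows "(u \<longlongrightarrow> c / r) at_top"
proof -
  have "((\<lambda>t. (exp (r * t) * u t) / exp (r * t)) \<longlongrightarrow> c / r) at_top"
  proof (rule lhospital_at_top_at_top)
    show "filterlim (\<lambda>t. exp (r * t)) at_top at_top"
      using r by real_asymp
    show "\<forall>\<^sub>F t in at_top. r * exp (r * t) \<noteq> 0"
      using r by simp
    show "\<forall>\<^sub>F t in at_top. ((\<lambda>t. exp (r * t)) has_real_derivative r * exp (r * t)) (at t)"
      by (intro always_eventually allI) (auto intro!: derivative_eq_intros)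
    show "\<forall>\<^sub>F t in at_top.
        ((\<lambda>t. exp (r * t) * u t) has_real_derivative exp (r * t) * v t) (at t)"
      using eventually_gt_at_top[of 0]
    proof eventually_elim
      case (elim t)
      show ?case
        by (rule derivative_eq_intros deriv[OF elim] refl)+ (simp add: algebra_simps)
    qed
    show "((\<lambda>t. exp (r * t) * v t / (r * exp (r * t))) \<longlongrightarrow> c / r) at_top"
      using tendsto_divide[OF lim tendsto_const[of r]] r by simp
  qed
  thus ?thesis by simp
qed

section \<open>Transition functions on a finite state space\<close>

text \<open>
  With differences of \<open>h\<close> in the summands, this is the usual matrix action for the diagonal that
  makes the row sums of \<open>q\<close> vanish.
\<close>

definition generator :: "'s set \<Rightarrow> ('s \<Rightarrow> 's \<Rightarrow> real) \<Rightarrow> ('s \<Rightarrow> real) \<Rightarrow> 's \<Rightarrow> real" where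
  "generator S q h i = (\<Sum>j\<in>S. q i j * (h j - h i))"

text \<open>
  Time is the last argument so that the expectation of \<open>h\<close> for a fixed starting point \<open>i\<close> can be
  differentiated as a function.
\<close>

definition semigroup_mean ::
  "'s set \<Rightarrow> (real \<Rightarrow> 's \<Rightarrow> 's \<Rightarrow> real) \<Rightarrow> ('s \<Rightarrow> real) \<Rightarrow> 's \<Rightarrow> real \<Rightarrow> real" where
  "semigroup_mean S P h i t = (\<Sum>j\<in>S. P t i j * h j)"

locale finite_transition_function =
  fixes S :: "'s set" and q P
  assumes finite_S: "finite S"
    and transition: "transition_function S q P"
begin

abbreviation "mean \<equiv> semigroup_mean S P"

lemmas transition_laws = transition[unfolded transition_function_def]

lemma P_nonneg: "0 \<le> t \<Longrightarrow> i \<in> S \<Longrightarrow> j \<in> S \<Longrightarrow> 0 \<le> P t i j"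
  using transition_laws[THEN conjunct1] by blast

lemma P_row_sum: "0 \<le> t \<Longrightarrow> i \<in> S \<Longrightarrow> (\<Sum>j\<in>S. P t i j) = 1"
  using transition_laws[THEN conjunct2, THEN conjunct1] by blast

lemma P_zero: "i \<in> S \<Longrightarrow> j \<in> S \<Longrightarrow> P 0 i j = (if i = j then 1 else 0)"
  using transition_laws[THEN conjunct2, THEN conjunct2, THEN conjunct1] by blast

lemma P_add:
  "0 \<le> s \<Longrightarrow> 0 \<le> t \<Longrightarrow> i \<in> S \<Longrightarrow> j \<in> S \<Longrightarrow> P (s + t) i j = (\<Sum>k\<in>S. P s i k * P t k j)"
  using transition_laws[THEN conjunct2, THEN conjunct2, THEN conjunct2, THEN conjunct1] by blast

lemma P_deriv: "i \<in> S \<Longrightarrow> j \<in> S \<Longrightarrow> i \<noteq> j \<Longrightarrow>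
    ((\<lambda>t. P t i j) has_real_derivative q i j) (at 0 within {0..})"
  using transition_laws[THEN conjunct2, THEN conjunct2, THEN conjunct2, THEN conjunct2] by blast

lemma P_le_1:
  assumes "0 \<le> t" "i \<in> S" "j \<in> S"
  shows "P t i j \<le> 1"
proof -
  have "P t i j \<le> (\<Sum>k\<in>S. P t i k)"
    using assms by (intro member_le_sum finite_S P_nonneg) auto
  thus ?thesis using P_row_sum[OF assms(1,2)] by simp
qed

lemma mean_zero:
  assumes "i \<in> S"
  shows "mean h i 0 = h i"
proof -
  have "mean h i 0 = (\<Sum>j\<in>S. if i = j then h j else 0)"
    unfolding semigroup_mean_def using assms by (intro sum.cong) (simp_all add: P_zero)
  thus ?thesis using assms finite_S by simp
qed

text \<open>
  The increment is expressed by the behaviour of the semigroup near time 0, whose derivative there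
  is the only one that is known.
\<close>

lemma mean_diff:
  assumes "0 \<le> s" "0 \<le> t" "i \<in> S"
  shows "mean h i (s + t) - mean h i s = (\<Sum>k\<in>S. P s i k * (mean h k t - h k))"
proof -
  have "mean h i (s + t) = (\<Sum>j\<in>S. \<Sum>k\<in>S. P s i k * P t k j * h j)"
    unfolding semigroup_mean_def
    using P_add[OF assms] by (intro sum.cong) (simp_all only: sum_distrib_right)
  also have "\<dots> = (\<Sum>k\<in>S. P s i k * mean h k t)"
    unfolding semigroup_mean_def by (subst sum.swap) (simp only: sum_distrib_left mult.assoc)
  finally show ?thesis
    by (simp only: semigroup_mean_def[of S P h i s] right_diff_distrib sum_subtractf)
qed

text \<open>
  Since the rows sum to 1, the difference \<open>mean h i t - h i\<close> only involves off-diagonal entries,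
  which have prescribed derivatives.
\<close>

lemma mean_quotient_at_zero:
  assumes "i \<in> S"
  shows "((\<lambda>t. (mean h i t - h i) / t) \<longlongrightarrow> generator S q h i) (at_right 0)"
proof -
  have "((\<lambda>t. \<Sum>j\<in>S. (P t i j / t) * (h j - h i)) \<longlongrightarrow> generator S q h i) (at_right 0)"
    unfolding generator_def
  proof (intro tendsto_sum)
    fix j assume j: "j \<in> S"
    show "((\<lambda>t. P t i j / t * (h j - h i)) \<longlongrightarrow> q i j * (h j - h i)) (at_right 0)"
    proof (cases "i = j")
      case False
      have "((\<lambda>t. P t i j / t) \<longlongrightarrow> q i j) (at_right 0)"
        using P_deriv[OF assms j False] P_zero[OF assms j] False
        by (simp add: has_field_derivative_iff at_within_Ici_at_right)
      thus ?thesis by (intro tendsto_intros)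
    qed simp
  qed
  moreover have "(\<Sum>j\<in>S. (P t i j / t) * (h j - h i)) = (mean h i t - h i) / t" if "0 < t" for t
  proof -
    have "(\<Sum>j\<in>S. P t i j * (h j - h i)) = mean h i t - h i"
      using that assms P_row_sum[of t i]
      by (simp only: semigroup_mean_def right_diff_distrib sum_subtractf flip: sum_distrib_right)
    thus ?thesis by (simp flip: sum_divide_distrib)
  qed
  hence "\<forall>\<^sub>F t in at_right 0. (\<Sum>j\<in>S. (P t i j / t) * (h j - h i)) = (mean h i t - h i) / t"
    using eventually_at_right_less[of "0::real"] by (rule eventually_mono[rotated])
  ultimately show ?thesis by (rule Lim_transform_eventually)
qed

lemma mean_continuous_at_zero:
  assumes "i \<in> S"
  shows "((\<lambda>t. mean h i t - h i) \<longlongrightarrow> 0) (at_right 0)"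
proof -
  have "((\<lambda>t. (mean h i t - h i) / t * t) \<longlongrightarrow> generator S q h i * 0) (at_right 0)"
    by (intro tendsto_mult mean_quotient_at_zero assms tendsto_ident_at)
  moreover have "\<forall>\<^sub>F t in at_right 0. (mean h i t - h i) / t * t = mean h i t - h i"
    using eventually_at_right_less[of "0::real"] by eventually_elim simp
  ultimately show ?thesis using Lim_transform_eventually by fastforce
qed

text \<open>
  Continuity from the left is what extends the one-sided derivative at time 0 to a two-sided one at
  later times. Since the entries of \<open>P (t - s)\<close> lie between 0 and 1, the error
  made by replacing \<open>t - s\<close> by \<open>t\<close> is controlled by the deviation of \<open>P s\<close> from the identity.
\<close>

lemma P_left_continuous:
  assumes "0 < t" "i \<in> S" "j \<in> S"
  shows "((\<lambda>s. P (t - s) i j) \<longlongrightarrow> P t i j) (at_right 0)"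
proof -
  let ?h = "\<lambda>k. if k = j then 1 else 0 :: real"
  have mean_h: "mean ?h k s = P s k j" for k s
    using finite_S assms(3)
    by (simp add: semigroup_mean_def if_distrib[of "\<lambda>x. _ * x"] cong: if_cong)
  have "((\<lambda>s. \<Sum>k\<in>S. \<bar>mean ?h k s - ?h k\<bar>) \<longlongrightarrow> (\<Sum>k\<in>S. \<bar>0\<bar>)) (at_right 0)"
    by (intro tendsto_sum tendsto_rabs mean_continuous_at_zero)
  hence lim: "((\<lambda>s. \<Sum>k\<in>S. \<bar>mean ?h k s - ?h k\<bar>) \<longlongrightarrow> 0) (at_right 0)"
    by simp
  have "\<forall>\<^sub>F s in at_right 0. norm (P (t - s) i j - P t i j) \<le> (\<Sum>k\<in>S. \<bar>mean ?h k s - ?h k\<bar>)"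
    using eventually_at_right_less[of 0] eventually_at_right_real[OF assms(1)]
  proof eventually_elim
    case (elim s)
    hence s: "0 \<le> t - s" "0 \<le> s" by auto
    have "\<bar>P t i j - P (t - s) i j\<bar> = \<bar>\<Sum>k\<in>S. P (t - s) i k * (mean ?h k s - ?h k)\<bar>"
      using mean_diff[OF s assms(2), of ?h] by (simp add: mean_h)
    also have "\<dots> \<le> (\<Sum>k\<in>S. \<bar>P (t - s) i k * (mean ?h k s - ?h k)\<bar>)"
      by (rule sum_abs)
    also have "\<dots> \<le> (\<Sum>k\<in>S. \<bar>mean ?h k s - ?h k\<bar>)"
      using P_nonneg[OF s(1) assms(2)] P_le_1[OF s(1) assms(2)]
      by (intro sum_mono) (simp add: abs_mult mult_left_le_one_le)
    finally show ?case by (simp add: abs_minus_commute)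
  qed
  from Lim_null_comparison[OF this lim] show ?thesis
    by (rule LIM_zero_cancel)
qed

text \<open>
  Kolmogorov's forward equation. The right difference quotient at \<open>t\<close> averages the quotients at
  time 0 with the weights \<open>P t i\<close>; the left one uses the weights \<open>P (t - s) i\<close>, which converge to
  the same values.
\<close>

lemma forward_equation:
  assumes t: "0 \<le> t" and i: "i \<in> S"
  shows "(mean h i has_real_derivative mean (generator S q h) i t) (at t within {0..})"
proof -
  let ?D = "\<lambda>s k. (mean h k s - h k) / s"
  have right: "((\<lambda>s. (mean h i (t + s) - mean h i t) / s) \<longlongrightarrow> mean (generator S q h) i t)
      (at_right 0)"
  proof (rule Lim_transform_eventually)
    show "((\<lambda>s. \<Sum>k\<in>S. P t i k * ?D s k) \<longlongrightarrow> mean (generator S q h) i t) (at_right 0)"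
      unfolding semigroup_mean_def[of S P "generator S q h"]
      by (intro tendsto_sum tendsto_mult tendsto_const mean_quotient_at_zero)
    show "\<forall>\<^sub>F s in at_right 0. (\<Sum>k\<in>S. P t i k * ?D s k) = (mean h i (t + s) - mean h i t) / s"
      using eventually_at_right_less[of "0::real"]
    proof eventually_elim
      case (elim s)
      thus ?case using mean_diff[OF t _ i, of s h] by (simp add: sum_divide_distrib)
    qed
  qed
  show ?thesis
  proof (cases "t = 0")
    case True
    with right show ?thesis
      by (simp add: has_field_derivative_iff at_within_Ici_at_right)
  next
    case False
    with t have "0 < t" by simp
    have "((\<lambda>s. (mean h i (t - s) - mean h i t) / - s) \<longlongrightarrow> mean (generator S q h) i t)
      (at_right 0)"
    proof (rule Lim_transform_eventually)
      show "((\<lambda>s. \<Sum>k\<in>S. P (t - s) i k * ?D s k) \<longlongrightarrow> mean (generator S q h) i t) (at_right 0)"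
        unfolding semigroup_mean_def[of S P "generator S q h"]
        by (intro tendsto_sum tendsto_mult P_left_continuous mean_quotient_at_zero \<open>0 < t\<close> i)
      show "\<forall>\<^sub>F s in at_right 0.
          (\<Sum>k\<in>S. P (t - s) i k * ?D s k) = (mean h i (t - s) - mean h i t) / - s"
        using eventually_at_right_less[of "0::real"] eventually_at_right_real[OF \<open>0 < t\<close>]
      proof eventually_elim
        case (elim s)
        hence "mean h i t - mean h i (t - s) = (\<Sum>k\<in>S. P (t - s) i k * (mean h k s - h k))"
          using mean_diff[of "t - s" s i h] i by simp
        moreover have "(\<Sum>k\<in>S. P (t - s) i k * ?D s k)
            = (\<Sum>k\<in>S. P (t - s) i k * (mean h k s - h k)) / s"
          by (simp add: sum_divide_distrib)
        ultimately show ?case by (simp add: field_simps)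
      qed
    qed
    hence left: "((\<lambda>s. (mean h i (t + s) - mean h i t) / s) \<longlongrightarrow> mean (generator S q h) i t)
        (at_left 0)"
      by (subst filterlim_at_left_to_right) simp
    from left right have "(mean h i has_real_derivative mean (generator S q h) i t) (at t)"
      unfolding DERIV_def filterlim_at_split by simp
    thus ?thesis by (rule has_field_derivative_at_within)
  qed
qed

lemma mean_conserved:
  assumes "\<And>j. j \<in> S \<Longrightarrow> generator S q h j = 0" "0 \<le> t" "i \<in> S"
  shows "mean h i t = h i"
proof -
  have "\<exists>c. \<forall>s\<in>{0..}. mean h i s = c"
  proof (rule has_field_derivative_zero_constant)
    fix s :: real assume "s \<in> {0..}"
    moreover have "mean (generator S q h) i s = 0"
      using assms by (simp add: semigroup_mean_def)
    ultimately show "(mean h i has_real_derivative 0) (at s within {0..})"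
      using forward_equation[of s i h] assms by simp
  qed simp
  thus ?thesis using assms mean_zero[of i h] by (metis atLeast_iff order_refl)
qed

text \<open>
  A class of states whose indicator is annihilated by the generator keeps its probability,
  so a chain that starts inside cannot put mass outside.
\<close>

lemma invariant_class:
  assumes "\<And>j. j \<in> S \<Longrightarrow> generator S q (indicator C) j = 0"
    and "0 \<le> t" "i \<in> S \<inter> C" "j \<in> S - C"
  shows "P t i j = 0"
proof -
  have "(\<Sum>k\<in>S. P t i k * indicator C k) = (\<Sum>k\<in>S. P t i k)"
    using mean_conserved[OF assms(1), of t i] P_row_sum[of t i] assms
    by (simp add: semigroup_mean_def)
  hence "(\<Sum>k\<in>S. P t i k * (1 - indicator C k)) = 0"
    by (simp add: right_diff_distrib sum_subtractf)
  moreover have "\<forall>k\<in>S. 0 \<le> P t i k * (1 - indicator C k)"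
    using P_nonneg assms by (auto simp: indicator_def)
  ultimately have "P t i j * (1 - indicator C j) = 0"
    using sum_nonneg_eq_0_iff[OF finite_S, of "\<lambda>k. P t i k * (1 - indicator C k)"] assms by blast
  thus ?thesis using assms by simp
qed

lemma mean_const: "0 \<le> t \<Longrightarrow> i \<in> S \<Longrightarrow> mean (\<lambda>_. c) i t = c"
  using P_row_sum[of t i] by (simp add: semigroup_mean_def flip: sum_distrib_right)

lemma mean_scale: "mean (\<lambda>j. a * f j) i t = a * mean f i t"
  by (simp add: semigroup_mean_def sum_distrib_left algebra_simps)

lemma mean_linear: "mean (\<lambda>j. a * f j + b * g j) i t = a * mean f i t + b * mean g i t"
  by (simp add: semigroup_mean_def sum.distrib sum_distrib_left algebra_simps)

lemma generator_linear:
  "generator S q (\<lambda>j. a * f j + b * g j) i = a * generator S q f i + b * generator S q g i"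
  by (simp add: generator_def sum_distrib_left flip: sum.distrib) (simp add: algebra_simps)

text \<open>
  The tool for the whole computation: the generator equation \<open>L h = g - r h\<close> is required only on an
  invariant class that contains the starting point. There it becomes a scalar differential equation
  for the mean of \<open>h\<close> driven by the mean of \<open>g\<close>.
\<close>

lemma mean_relaxation:
  assumes C: "\<And>j. j \<in> S \<Longrightarrow> generator S q (indicator C) j = 0"
    and i: "i \<in> S \<inter> C"
    and r: "0 < r"
    and gen: "\<And>j. j \<in> S \<inter> C \<Longrightarrow> generator S q h j = g j - r * h j"
    and lim: "(mean g i \<longlongrightarrow> c) at_top"
  shows "(mean h i \<longlongrightarrow> c / r) at_top"
proof (rule linear_relaxation[OF r _ lim])
  fix t :: real assume t: "0 < t"
  have "mean (generator S q h) i t = mean (\<lambda>j. 1 * g j + (- r) * h j) i t"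
    unfolding semigroup_mean_def
  proof (intro sum.cong refl)
    fix j assume "j \<in> S"
    thus "P t i j * generator S q h j = P t i j * (1 * g j + (- r) * h j)"
      using gen[of j] invariant_class[OF C, of t i j] t i by (cases "j \<in> C") auto
  qed
  also have "\<dots> = mean g i t - r * mean h i t"
    by (subst mean_linear) simp
  finally show "(mean h i has_real_derivative mean g i t - r * mean h i t) (at t)"
    using forward_equation[of t i h] t i by (simp add: at_within_interior[of t "{0..}"])
qed

end

section \<open>The generator of the exclusion process\<close>

lemma exchange_occupied:
  assumes "x \<in> \<eta>"
  shows "exchange x y \<eta> = (if y \<in> \<eta> then \<eta> else insert y (\<eta> - {x}))"
  using assms by (auto simp: exchange_def Transposition.transpose_def split: if_splits)

text \<open>
  Summing over attempted jumps is more convenient than summing over target configurations. A jump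
  to an occupied vertex contributes 0, because exchanging two occupied vertices changes nothing;
  the blocked jumps may therefore stay in the sum.
\<close>

lemma exclusion_generator:
  fixes V :: "'v set"
  assumes "finite V" "\<eta> \<subseteq> V"
  shows "generator (Pow V) (exclusion_rate V E \<rho>) h \<eta> =
    (\<Sum>x\<in>\<eta>. \<rho> x / real (vertex_degree V E x) *
      (\<Sum>y\<in>{y\<in>V. {x, y} \<in> E}. h (exchange x y \<eta>) - h \<eta>))"
proof -
  define A where "A = {(x, y) \<in> V \<times> V. {x, y} \<in> E \<and> x \<in> \<eta>}"
  let ?c = "\<lambda>x. \<rho> x / real (vertex_degree V E x)"
  have finA: "finite A"
    unfolding A_def by (rule finite_subset[of _ "V \<times> V"]) (use assms in auto)
  have A_Sigma: "A = Sigma \<eta> (\<lambda>x. {y\<in>V. {x, y} \<in> E})"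
    using assms by (auto simp: A_def)
  have in_Pow: "exchange x y \<eta> \<in> Pow V" if "(x, y) \<in> A" for x y
    using that assms by (auto simp: A_def exchange_occupied)
  have rate: "exclusion_rate V E \<rho> \<eta> \<xi> * (h \<xi> - h \<eta>) =
      (\<Sum>(x, y)\<in>A. if \<xi> = exchange x y \<eta> then ?c x * (h \<xi> - h \<eta>) else 0)" for \<xi>
  proof (cases "\<xi> = \<eta>")
    case True
    thus ?thesis
      by (simp only: exclusion_rate_def) (auto simp: case_prod_beta intro!: sum.neutral)
  next
    case False
    have B: "{(x, y) \<in> V \<times> V. {x, y} \<in> E \<and> x \<in> \<eta> \<and> \<xi> = exchange x y \<eta>}
        = {p \<in> A. \<xi> = exchange (fst p) (snd p) \<eta>}"
      by (auto simp: A_def)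
    show ?thesis
      unfolding exclusion_rate_def B
      using False by (simp add: sum.inter_filter[OF finA] sum_distrib_right case_prod_beta
          if_distribR if_distrib[of "\<lambda>c. c * _"] cong: if_cong)
  qed
  have "generator (Pow V) (exclusion_rate V E \<rho>) h \<eta> =
      (\<Sum>(x, y)\<in>A. \<Sum>\<xi>\<in>Pow V. if \<xi> = exchange x y \<eta> then ?c x * (h \<xi> - h \<eta>) else 0)"
    unfolding generator_def rate by (subst sum.swap) (simp add: case_prod_beta)
  also have "\<dots> = (\<Sum>(x, y)\<in>A. ?c x * (h (exchange x y \<eta>) - h \<eta>))"
    using in_Pow assms by (intro sum.cong) auto
  also have "\<dots> = (\<Sum>x\<in>\<eta>. \<Sum>y\<in>{y\<in>V. {x, y} \<in> E}. ?c x * (h (exchange x y \<eta>) - h \<eta>))"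
    unfolding A_Sigma using assms by (subst sum.Sigma) (auto intro: finite_subset)
  finally show ?thesis by (simp add: sum_distrib_left)
qed

lemma card_exchange:
  assumes "finite \<eta>" "x \<in> \<eta>"
  shows "card (exchange x y \<eta>) = card \<eta>"
proof -
  have "0 < card \<eta>" using assms by (auto simp: card_gt_0_iff)
  thus ?thesis using assms by (auto simp: exchange_occupied)
qed

lemma exclusion_conserves_card:
  assumes "finite V" "\<eta> \<subseteq> V"
  shows "generator (Pow V) (exclusion_rate V E \<rho>) (indicator {\<xi>. card \<xi> = K}) \<eta> = 0"
  unfolding exclusion_generator[OF assms]
  by (intro sum.neutral ballI)
    (simp add: indicator_def card_exchange finite_subset[OF assms(2,1)])

section \<open>The star graph\<close>

lemma star_neighbours:
  assumes "x < N"
  shows "{y\<in>{0..<N}. {x, y} \<in> star_edges N} = (if x = 0 then {1..<N} else {0})"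
proof -
  have edge: "{x, y} \<in> star_edges N \<longleftrightarrow> x = 0 \<and> y \<in> {1..<N} \<or> y = 0 \<and> x \<in> {1..<N}" for y
    unfolding star_edges_def image_iff doubleton_eq_iff by blast
  show ?thesis
    unfolding edge using assms by (cases "x = 0") auto
qed

text \<open>
  The first term collects the jumps of a particle at the centre, the second those of the leaf
  particles, whose only neighbour is the centre.
\<close>

lemma star_generator:
  assumes "\<eta> \<subseteq> {0..<N}"
  shows "generator (Pow {0..<N}) (exclusion_rate {0..<N} (star_edges N) (\<lambda>_. 1)) h \<eta> =
    (if 0 \<in> \<eta> then (\<Sum>y\<in>{1..<N}. h (exchange 0 y \<eta>) - h \<eta>) / (real N - 1) else 0) +
    (\<Sum>x\<in>\<eta> - {0}. h (exchange x 0 \<eta>) - h \<eta>)"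
proof -
  let ?nb = "\<lambda>x. if x = 0 then {1..<N} else {0}"
  let ?d = "\<lambda>x. 1 / real (card (?nb x)) * (\<Sum>y\<in>?nb x. h (exchange x y \<eta>) - h \<eta>)"
  have fin: "finite \<eta>" using assms finite_subset by blast
  have "generator (Pow {0..<N}) (exclusion_rate {0..<N} (star_edges N) (\<lambda>_. 1)) h \<eta> = sum ?d \<eta>"
    unfolding exclusion_generator[OF finite_atLeastLessThan assms] vertex_degree_def
  proof (intro sum.cong refl)
    fix x assume "x \<in> \<eta>"
    with assms have "x < N" by auto
    show "1 / real (card {y \<in> {0..<N}. {x, y} \<in> star_edges N}) *
        (\<Sum>y\<in>{y \<in> {0..<N}. {x, y} \<in> star_edges N}. h (exchange x y \<eta>) - h \<eta>) = ?d x"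
      unfolding star_neighbours[OF \<open>x < N\<close>] ..
  qed
  also have "\<dots> = (if 0 \<in> \<eta> then ?d 0 else 0) + sum ?d (\<eta> - {0})"
    using fin by (cases "0 \<in> \<eta>")
      (simp_all only: sum.remove if_True if_False Diff_insert0 Diff_empty add_0_left not_False_eq_True)
  also have "sum ?d (\<eta> - {0}) = (\<Sum>x\<in>\<eta> - {0}. h (exchange x 0 \<eta>) - h \<eta>)"
    by (intro sum.cong) auto
  also have "(if 0 \<in> \<eta> then ?d 0 else 0) =
      (if 0 \<in> \<eta> then (\<Sum>y\<in>{1..<N}. h (exchange 0 y \<eta>) - h \<eta>) / (real N - 1) else 0)"
    using assms by auto
  finally show ?thesis .
qed

abbreviation star_exclusion_generator :: "nat \<Rightarrow> (nat set \<Rightarrow> real) \<Rightarrow> nat set \<Rightarrow> real" where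
  "star_exclusion_generator N \<equiv>
    generator (Pow {0..<N}) (exclusion_rate {0..<N} (star_edges N) (\<lambda>_. 1))"

lemma sum_empty_leaves:
  assumes "\<eta> \<subseteq> {0..<N}" "0 \<in> \<eta>"
  shows "(\<Sum>y\<in>{1..<N}. - of_bool (y \<notin> \<eta>) :: real) = - (real N - real (card \<eta>))"
proof -
  have "{1..<N} \<inter> {y. y \<notin> \<eta>} = {0..<N} - \<eta>"
    using assms(2) by (auto simp: Suc_le_eq intro: gr0I)
  moreover have "real (card ({0..<N} - \<eta>)) = real N - real (card \<eta>)"
    using assms finite_subset[OF assms(1)] card_mono[OF _ assms(1)]
    by (simp add: card_Diff_subset)
  ultimately show ?thesis by (simp add: sum_negf)
qed

text \<open>
  A particle at the centre leaves at a rate equal to the proportion of empty leaves, and an empty centre receives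
  every leaf particle at rate 1.
\<close>

lemma star_generator_center:
  assumes "\<eta> \<subseteq> {0..<N}"
  shows "star_exclusion_generator N (\<lambda>\<xi>. of_bool (0 \<in> \<xi>)) \<eta> =
    real (card \<eta>) -
      (real (card \<eta>) + (real N - real (card \<eta>)) / (real N - 1)) * of_bool (0 \<in> \<eta>)"
proof (cases "0 \<in> \<eta>")
  case True
  have fin: "finite \<eta>" using assms finite_subset by blast
  have "(\<Sum>y\<in>{1..<N}. of_bool (0 \<in> exchange 0 y \<eta>) - of_bool (0 \<in> \<eta>) :: real)
      = (\<Sum>y\<in>{1..<N}. - of_bool (y \<notin> \<eta>))"
    using True by (intro sum.cong) (auto simp: exchange_occupied)
  also note sum_empty_leaves[OF assms True]
  finally have 1: "(\<Sum>y\<in>{1..<N}. of_bool (0 \<in> exchange 0 y \<eta>) - of_bool (0 \<in> \<eta>) :: real)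
      = - (real N - real (card \<eta>))" .
  have 2: "(\<Sum>x\<in>\<eta> - {0}. of_bool (0 \<in> exchange x 0 \<eta>) - of_bool (0 \<in> \<eta>) :: real) = 0"
    using True by (intro sum.neutral) (auto simp: exchange_occupied)
  show ?thesis
    unfolding star_generator[OF assms] 1 2 using True by (simp add: minus_divide_left)
next
  case False
  hence "(\<Sum>x\<in>\<eta> - {0}. of_bool (0 \<in> exchange x 0 \<eta>) - of_bool (0 \<in> \<eta>) :: real)
      = (\<Sum>x\<in>\<eta>. 1)"
    by (intro sum.cong) (auto simp: exchange_occupied)
  with False show ?thesis
    by (simp only: star_generator[OF assms]) simp
qed

text \<open>
  The leaf gains a particle at rate \<open>1 / (N - 1)\<close> when the centre is occupied and the leaf empty, and
  loses one at rate 1 in the opposite situation; the products of indicators give the pair term.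
\<close>

lemma star_generator_leaf:
  assumes "2 \<le> N" "\<eta> \<subseteq> {0..<N}" "x \<in> {1..<N}"
  shows "star_exclusion_generator N (\<lambda>\<xi>. of_bool (x \<in> \<xi>)) \<eta> =
    of_bool (0 \<in> \<eta>) / (real N - 1) - of_bool (x \<in> \<eta>) +
      (real N - 2) / (real N - 1) * of_bool (0 \<in> \<eta> \<and> x \<in> \<eta>)"
proof (cases "0 \<in> \<eta>")
  case True
  have "(\<Sum>y\<in>{1..<N}. of_bool (x \<in> exchange 0 y \<eta>) - of_bool (x \<in> \<eta>) :: real)
      = (\<Sum>y\<in>{1..<N}. if y = x then of_bool (x \<notin> \<eta>) else 0)"
    using True assms by (intro sum.cong) (auto simp: exchange_occupied)
  also have "\<dots> = of_bool (x \<notin> \<eta>)"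
    using assms by simp
  finally have 1: "(\<Sum>y\<in>{1..<N}. of_bool (x \<in> exchange 0 y \<eta>) - of_bool (x \<in> \<eta>) :: real)
      = of_bool (x \<notin> \<eta>)" .
  have 2: "(\<Sum>z\<in>\<eta> - {0}. of_bool (x \<in> exchange z 0 \<eta>) - of_bool (x \<in> \<eta>) :: real) = 0"
    using True by (intro sum.neutral) (auto simp: exchange_occupied)
  show ?thesis
    unfolding star_generator[OF assms(2)] 1 2
    using True assms(1) by (cases "x \<in> \<eta>") (simp_all add: divide_simps)
next
  case False
  have fin: "finite \<eta>" using assms finite_subset by blast
  have "(\<Sum>z\<in>\<eta> - {0}. of_bool (x \<in> exchange z 0 \<eta>) - of_bool (x \<in> \<eta>) :: real)
      = (\<Sum>z\<in>\<eta>. if z = x then -1 else 0)"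
    using False assms by (intro sum.cong) (auto simp: exchange_occupied)
  also have "\<dots> = - of_bool (x \<in> \<eta>)"
    using fin by simp
  finally show ?thesis
    unfolding star_generator[OF assms(2)] using False by simp
qed

text \<open>
  No further pair or triple of sites enters, which is why the equations close. The pair becomes
  occupied only when one of the other \<open>card \<eta> - 1\<close> particles fills an empty centre while \<open>x\<close> is
  occupied: if the centre is occupied and \<open>x\<close> empty, a jump to \<open>x\<close> vacates the centre. The pair is
  lost exactly when the centre's particle finds an empty leaf.
\<close>

lemma star_generator_pair:
  assumes "\<eta> \<subseteq> {0..<N}" "x \<in> {1..<N}"
  shows "star_exclusion_generator N (\<lambda>\<xi>. of_bool (0 \<in> \<xi> \<and> x \<in> \<xi>)) \<eta> =
    (real (card \<eta>) - 1) * of_bool (x \<in> \<eta>) -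
      (real (card \<eta>) - 1 + (real N - real (card \<eta>)) / (real N - 1)) *
        of_bool (0 \<in> \<eta> \<and> x \<in> \<eta>)"
proof (cases "x \<in> \<eta>")
  case False
  hence x: "x \<noteq> 0" "x \<notin> \<eta>" using assms by auto
  have "0 \<notin> exchange 0 y \<eta> \<or> x \<notin> exchange 0 y \<eta>" if "0 \<in> \<eta>" for y
    using that x by (auto simp: exchange_occupied)
  moreover have "x \<notin> exchange z 0 \<eta>" if "z \<in> \<eta>" for z
    using that x by (auto simp: exchange_occupied)
  ultimately show ?thesis
    unfolding star_generator[OF assms(1)] using False by (auto intro!: sum.neutral)
next
  case x: True
  have fin: "finite \<eta>" using assms finite_subset by blast
  show ?thesis
  proof (cases "0 \<in> \<eta>")
    case True
    have "(\<Sum>y\<in>{1..<N}. of_bool (0 \<in> exchange 0 y \<eta> \<and> x \<in> exchange 0 y \<eta>)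
          - of_bool (0 \<in> \<eta> \<and> x \<in> \<eta>) :: real)
        = (\<Sum>y\<in>{1..<N}. - of_bool (y \<notin> \<eta>))"
      using True x by (intro sum.cong) (auto simp: exchange_occupied)
    also note sum_empty_leaves[OF assms(1) True]
    finally have 1: "(\<Sum>y\<in>{1..<N}. of_bool (0 \<in> exchange 0 y \<eta> \<and> x \<in> exchange 0 y \<eta>)
          - of_bool (0 \<in> \<eta> \<and> x \<in> \<eta>) :: real) = - (real N - real (card \<eta>))" .
    have 2: "(\<Sum>z\<in>\<eta> - {0}. of_bool (0 \<in> exchange z 0 \<eta> \<and> x \<in> exchange z 0 \<eta>)
          - of_bool (0 \<in> \<eta> \<and> x \<in> \<eta>) :: real) = 0"
      using True x by (intro sum.neutral) (auto simp: exchange_occupied)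
    show ?thesis
      unfolding star_generator[OF assms(1)] 1 2 using True x by (simp add: minus_divide_left)
  next
    case False
    have "(\<Sum>z\<in>\<eta> - {0}. of_bool (0 \<in> exchange z 0 \<eta> \<and> x \<in> exchange z 0 \<eta>)
          - of_bool (0 \<in> \<eta> \<and> x \<in> \<eta>) :: real)
        = (\<Sum>z\<in>\<eta>. 1 - (if z = x then 1 else 0))"
      using False x assms by (intro sum.cong) (auto simp: exchange_occupied)
    also have "\<dots> = real (card \<eta>) - 1"
      using fin x by (simp add: sum_subtractf)
    finally show ?thesis
      unfolding star_generator[OF assms(1)] using False x by simp
  qed
qed

section \<open>Limits for the star\<close>

lemma reciprocal_roots:
  fixes s :: real
  assumes "2 \<le> s"
  obtains \<mu> \<nu> where "0 < \<mu>" "0 < \<nu>" "\<mu> + \<nu> = s" "\<mu> * \<nu> = 1"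
proof -
  let ?d = "sqrt (s\<^sup>2 - 4)"
  have "0 \<le> s\<^sup>2 - 4"
    using power_mono[OF assms, of 2] by simp
  hence sq: "?d\<^sup>2 = s\<^sup>2 - 4" by simp
  have "?d < sqrt (s\<^sup>2)" by (intro real_sqrt_less_mono) simp
  hence lt: "?d < s" using assms by simp
  show thesis
  proof (rule that)
    show "0 < (s + ?d) / 2" using \<open>0 \<le> s\<^sup>2 - 4\<close> assms by (simp add: add_pos_nonneg)
    show "0 < (s - ?d) / 2" using lt by simp
    show "(s + ?d) / 2 + (s - ?d) / 2 = s" by (simp add: field_simps)
    show "(s + ?d) / 2 * ((s - ?d) / 2) = 1"
      using sq by (simp add: field_simps power2_eq_square)
  qed
qed

lemma star_limits:
  assumes P: "transition_function (Pow {0..<N}) (exclusion_rate {0..<N} (star_edges N) (\<lambda>_. 1)) P"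
    and N: "2 \<le> N" and K: "0 < K" "K \<le> N"
    and \<eta>: "\<eta> \<subseteq> {0..<N}" "card \<eta> = K"
  shows star_limit_center: "(semigroup_mean (Pow {0..<N}) P (\<lambda>\<xi>. of_bool (0 \<in> \<xi>)) \<eta> \<longlongrightarrow>
      (real N - 1) * real K / ((real N - 1) * real K + (real N - real K))) at_top"
    and star_limit_leaf: "x \<in> {1..<N} \<Longrightarrow>
      (semigroup_mean (Pow {0..<N}) P (\<lambda>\<xi>. of_bool (x \<in> \<xi>)) \<eta> \<longlongrightarrow>
        real K / (real N - 1) *
        (((real N - 1) * real K - (real K - 1)) /
          ((real N - 1) * real K + (real N - real K)))) at_top"
proof -
  interpret finite_transition_function "Pow {0..<N}"
    "exclusion_rate {0..<N} (star_edges N) (\<lambda>_. 1)" P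
    using P by unfold_locales auto
  define n k where "n = real N" and "k = real K"
  have nk: "2 \<le> n" "1 \<le> k" "k \<le> n"
    using N K by (auto simp: n_def k_def)
  \<comment> \<open>the relaxation rate of the centre, and minus the trace of the system for leaf and pair\<close>
  define s where "s = k + (n - k) / (n - 1)"
  define C where "C = {\<xi> :: nat set. card \<xi> = K}"
  have C: "star_exclusion_generator N (indicator C) \<xi> = 0" if "\<xi> \<in> Pow {0..<N}" for \<xi>
    using that exclusion_conserves_card[of "{0..<N}" \<xi>] by (simp add: C_def)
  have \<eta>C: "\<eta> \<in> Pow {0..<N} \<inter> C"
    using \<eta> by (simp add: C_def)
  note relax = mean_relaxation[OF C \<eta>C]
  \<comment> \<open>\<open>s - 2\<close> equals \<open>(k - 1) (n - 2) / (n - 1)\<close>, so the eigenvalues below are real\<close>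
  have "0 \<le> (k - 1) * (n - 2)"
    using nk by simp
  hence s2: "2 \<le> s"
    using nk by (simp add: s_def field_simps)
  define c where "c = k / s"
  have center: "(mean (\<lambda>\<xi>. of_bool (0 \<in> \<xi>)) \<eta> \<longlongrightarrow> c) at_top"
    unfolding c_def
  proof (rule relax)
    show "0 < s" using s2 by simp
    show "star_exclusion_generator N (\<lambda>\<xi>. of_bool (0 \<in> \<xi>)) \<xi> = k - s * of_bool (0 \<in> \<xi>)"
      if "\<xi> \<in> Pow {0..<N} \<inter> C" for \<xi>
      using that star_generator_center[of \<xi>] by (simp add: C_def k_def n_def s_def)
    have "\<forall>\<^sub>F t in at_top. k = mean (\<lambda>_. k) \<eta> t"
      using eventually_ge_at_top[of 0] by eventually_elim (use \<eta>C in \<open>simp add: mean_const\<close>)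
    thus "(mean (\<lambda>_. k) \<eta> \<longlongrightarrow> k) at_top"
      by (rule Lim_transform_eventually[OF tendsto_const])
  qed
  have s_eq: "s * (n - 1) = (n - 1) * k + (n - k)"
    using nk by (simp add: s_def field_simps)
  have "c = (n - 1) * k / ((n - 1) * k + (n - k))"
    using nk by (simp add: c_def flip: s_eq)
  with center show "(mean (\<lambda>\<xi>. of_bool (0 \<in> \<xi>)) \<eta> \<longlongrightarrow>
      (real N - 1) * real K / ((real N - 1) * real K + (real N - real K))) at_top"
    by (simp add: n_def k_def)

  assume x: "x \<in> {1..<N}"
  obtain \<mu> \<nu> where roots: "0 < \<mu>" "0 < \<nu>" "\<mu> + \<nu> = s" "\<mu> * \<nu> = 1"
    using reciprocal_roots[OF s2] .
  define \<kappa> where "\<kappa> = (n - 2) / (n - 1)"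
  let ?center = "\<lambda>\<xi>::nat set. of_bool (0 \<in> \<xi>) :: real"
  let ?leaf = "\<lambda>\<xi>. of_bool (x \<in> \<xi>) :: real"
  let ?pair = "\<lambda>\<xi>. of_bool (0 \<in> \<xi> \<and> x \<in> \<xi>) :: real"
  \<comment> \<open>the combination that decouples from the leaf and decays at rate \<open>\<nu>\<close>\<close>
  let ?u = "\<lambda>\<xi>. (\<mu> - 1) * ?leaf \<xi> + \<kappa> * ?pair \<xi>"
  have gen_leaf: "star_exclusion_generator N ?leaf \<xi> =
      ?center \<xi> / (n - 1) - ?leaf \<xi> + \<kappa> * ?pair \<xi>" if "\<xi> \<in> Pow {0..<N} \<inter> C" for \<xi>
    using that star_generator_leaf[OF N _ x, of \<xi>] by (simp add: n_def \<kappa>_def)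
  have gen_pair: "star_exclusion_generator N ?pair \<xi> = (k - 1) * ?leaf \<xi> - (s - 1) * ?pair \<xi>"
    if "\<xi> \<in> Pow {0..<N} \<inter> C" for \<xi>
    using that star_generator_pair[OF _ x, of \<xi>]
    by (simp add: n_def k_def s_def C_def algebra_simps)
  \<comment> \<open>this says that the determinant \<open>(s - 1) - \<kappa> (k - 1)\<close> is 1\<close>
  have \<kappa>_eq: "\<kappa> * (k - 1) = s - 2"
    using nk by (simp add: \<kappa>_def s_def field_simps)
  have u_lim: "(mean ?u \<eta> \<longlongrightarrow> ((\<mu> - 1) / (n - 1) * c) / \<nu>) at_top"
  proof (rule relax)
    show "0 < \<nu>" by (fact roots)
    show "star_exclusion_generator N ?u \<xi> = (\<mu> - 1) / (n - 1) * ?center \<xi> - \<nu> * ?u \<xi>"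
      if \<xi>: "\<xi> \<in> Pow {0..<N} \<inter> C" for \<xi>
    proof -
      have "star_exclusion_generator N ?u \<xi> =
          (\<mu> - 1) * (?center \<xi> / (n - 1) - ?leaf \<xi> + \<kappa> * ?pair \<xi>) +
          \<kappa> * ((k - 1) * ?leaf \<xi> - (s - 1) * ?pair \<xi>)"
        by (simp only: generator_linear gen_leaf[OF \<xi>] gen_pair[OF \<xi>])
      also have "\<dots> = (\<mu> - 1) / (n - 1) * ?center \<xi> + (\<kappa> * (k - 1) - (\<mu> - 1)) * ?leaf \<xi>
          - (s - \<mu>) * \<kappa> * ?pair \<xi>"
        by (simp add: algebra_simps)
      also have "\<kappa> * (k - 1) - (\<mu> - 1) = - \<nu> * (\<mu> - 1)"
        unfolding \<kappa>_eq using roots by (simp add: algebra_simps)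
      also have "s - \<mu> = \<nu>"
        using roots by simp
      finally show ?thesis by (simp add: algebra_simps)
    qed
    show "(mean (\<lambda>\<xi>. (\<mu> - 1) / (n - 1) * ?center \<xi>) \<eta> \<longlongrightarrow> (\<mu> - 1) / (n - 1) * c) at_top"
      unfolding mean_scale by (intro tendsto_mult tendsto_const center)
  qed
  have "(mean ?leaf \<eta> \<longlongrightarrow>
      (1 * (((\<mu> - 1) / (n - 1) * c) / \<nu>) + 1 / (n - 1) * c) / \<mu>) at_top"
  proof (rule relax)
    show "0 < \<mu>" by (fact roots)
    show "star_exclusion_generator N ?leaf \<xi> = (1 * ?u \<xi> + 1 / (n - 1) * ?center \<xi>) - \<mu> * ?leaf \<xi>"
      if "\<xi> \<in> Pow {0..<N} \<inter> C" for \<xi>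
      using gen_leaf[OF that] by (simp add: algebra_simps)
    show "(mean (\<lambda>\<xi>. 1 * ?u \<xi> + 1 / (n - 1) * ?center \<xi>) \<eta> \<longlongrightarrow>
        1 * (((\<mu> - 1) / (n - 1) * c) / \<nu>) + 1 / (n - 1) * c) at_top"
      unfolding mean_linear[of 1] by (intro tendsto_intros u_lim center)
  qed
  moreover have "(1 * (((\<mu> - 1) / (n - 1) * c) / \<nu>) + 1 / (n - 1) * c) / \<mu> =
      k / (n - 1) * (((n - 1) * k - (k - 1)) / ((n - 1) * k + (n - k)))"
  proof -
    have "(1 * (((\<mu> - 1) / (n - 1) * c) / \<nu>) + 1 / (n - 1) * c) / \<mu> =
        c / (n - 1) * ((\<mu> - 1 + \<nu>) / (\<mu> * \<nu>))"
      using roots(1,2) nk by (simp add: divide_simps) (simp add: algebra_simps)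
    also have "\<mu> - 1 + \<nu> = s - 1"
      using roots by simp
    also have "c / (n - 1) * ((s - 1) / (\<mu> * \<nu>)) = k / (n - 1) * ((s * (n - 1) - (n - 1)) / (s * (n - 1)))"
      using roots(4) s2 nk by (simp add: c_def divide_simps) (simp add: algebra_simps)
    also have "s * (n - 1) - (n - 1) = (n - 1) * k - (k - 1)"
      unfolding s_eq by simp
    finally show ?thesis unfolding s_eq .
  qed
  ultimately show "(mean ?leaf \<eta> \<longlongrightarrow> real K / (real N - 1) *
      (((real N - 1) * real K - (real K - 1)) / ((real N - 1) * real K + (real N - real K)))) at_top"
    by (simp only: n_def k_def)
qed

section \<open>Conditioning on the initial state\<close>

context continuous_time_markov_chain
begin

text \<open>
  The conditional probability is a convex combination, with weights independent of \<open>t\<close>, of the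
  probabilities for fixed initial states, so a common limit of the latter passes to it.
\<close>

lemma conditional_limit:
  assumes lim: "\<And>P i. transition_function S q P \<Longrightarrow> i \<in> S \<Longrightarrow> A i \<Longrightarrow>
      (semigroup_mean S P (\<lambda>j. of_bool (B j)) i \<longlongrightarrow> c) at_top"
    and pos: "0 < \<P>(\<omega> in M. A (X 0 \<omega>))"
  shows "((\<lambda>t. \<P>(\<omega> in M. B (X t \<omega>) \<bar> A (X 0 \<omega>))) \<longlongrightarrow> c) at_top"
proof -
  obtain P where P: "transition_function S q P"
    and markov: "\<And>n (t :: nat \<Rightarrow> real) i. \<lbrakk>0 \<le> t 0; \<forall>k\<le>n. t k \<le> t (Suc k); \<forall>k\<le>Suc n. i k \<in> S;
      0 < \<P>(\<omega> in M. \<forall>k\<le>n. X (t k) \<omega> = i k)\<rbrakk> \<Longrightarrow>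
      \<P>(\<omega> in M. X (t (Suc n)) \<omega> = i (Suc n) \<bar> \<forall>k\<le>n. X (t k) \<omega> = i k)
        = P (t (Suc n) - t n) (i n) (i (Suc n))"
    using markov_property by blast
  have X_S: "X t \<omega> \<in> S" if "0 \<le> t" "\<omega> \<in> space M" for t \<omega>
    using measurable_space[OF measurable_state[OF that(1)] that(2)] by simp
  have event: "{\<omega>\<in>space M. Q (X t \<omega>)} \<in> events" if "0 \<le> t" for t Q
  proof -
    have "{\<omega>\<in>space M. Q (X t \<omega>)} = X t -` (S \<inter> Collect Q) \<inter> space M"
      using X_S that by auto
    moreover have "X t -` (S \<inter> Collect Q) \<inter> space M \<in> events"
      by (rule measurable_sets[OF measurable_state[OF that]]) simp
    ultimately show ?thesis by (simp only:)
  qed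
  have joint_event: "{\<omega>\<in>space M. Q (X t \<omega>) \<and> R (X 0 \<omega>)} \<in> events" if "0 \<le> t" for t Q R
    using event[OF that, of Q] event[OF order_refl, of R] by (intro sets.sets_Collect_conj)
  have joint: "\<P>(\<omega> in M. X t \<omega> = j \<and> X 0 \<omega> = i) = \<P>(\<omega> in M. X 0 \<omega> = i) * P t i j"
    if "0 \<le> t" "i \<in> S" "j \<in> S" for t i j
  \<comment> \<open>the Markov property says nothing about initial states of probability 0\<close>
  proof (cases "\<P>(\<omega> in M. X 0 \<omega> = i) = 0")
    case True
    have "\<P>(\<omega> in M. X t \<omega> = j \<and> X 0 \<omega> = i) \<le> \<P>(\<omega> in M. X 0 \<omega> = i)"
      using event[of 0 "\<lambda>y. y = i"] by (intro finite_measure_mono) auto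
    with True show ?thesis by (simp add: measure_le_0_iff)
  next
    case False
    let ?t = "\<lambda>k::nat. if k = 0 then 0 else t" and ?i = "\<lambda>k::nat. if k = 0 then i else j"
    have "0 < \<P>(\<omega> in M. \<forall>k\<le>0. X (?t k) \<omega> = ?i k)"
      using False by (simp add: zero_less_measure_iff)
    hence "\<P>(\<omega> in M. X t \<omega> = j \<bar> X 0 \<omega> = i) = P t i j"
      using markov[of ?t 0 ?i] that by simp
    thus ?thesis using False by (simp add: cond_prob_def field_simps)
  qed
  define A' where "A' = {i\<in>S. A i}"
  define B' where "B' = {j\<in>S. B j}"
  have fin: "finite A'" "finite B'"
    using finite_states by (auto simp: A'_def B'_def)
  have init: "\<P>(\<omega> in M. A (X 0 \<omega>)) = (\<Sum>i\<in>A'. \<P>(\<omega> in M. X 0 \<omega> = i))"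
  proof -
    have "{\<omega>\<in>space M. A (X 0 \<omega>)} = (\<Union>i\<in>A'. {\<omega>\<in>space M. X 0 \<omega> = i})"
      using X_S by (auto simp: A'_def)
    thus ?thesis
      using fin event[of 0] by (simp, intro finite_measure_finite_Union)
        (auto simp: disjoint_family_on_def)
  qed
  have mixture: "\<P>(\<omega> in M. B (X t \<omega>) \<and> A (X 0 \<omega>)) =
      (\<Sum>i\<in>A'. \<P>(\<omega> in M. X 0 \<omega> = i) * semigroup_mean S P (\<lambda>j. of_bool (B j)) i t)"
    if t: "0 \<le> t" for t
  proof -
    have mean_B: "semigroup_mean S P (\<lambda>j. of_bool (B j)) i t = (\<Sum>j\<in>B'. P t i j)" for i
      unfolding semigroup_mean_def B'_def sum.inter_filter[OF finite_states]
      by (intro sum.cong) auto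
    have "{\<omega>\<in>space M. B (X t \<omega>) \<and> A (X 0 \<omega>)} =
        (\<Union>p\<in>A' \<times> B'. {\<omega>\<in>space M. X t \<omega> = snd p \<and> X 0 \<omega> = fst p})"
      using X_S t by (auto simp: A'_def B'_def)
    hence "\<P>(\<omega> in M. B (X t \<omega>) \<and> A (X 0 \<omega>)) =
        (\<Sum>p\<in>A' \<times> B'. \<P>(\<omega> in M. X t \<omega> = snd p \<and> X 0 \<omega> = fst p))"
      using fin joint_event[OF t] by (simp, intro finite_measure_finite_Union)
        (auto simp: disjoint_family_on_def)
    also have "\<dots> = (\<Sum>(i, j)\<in>A' \<times> B'. \<P>(\<omega> in M. X 0 \<omega> = i) * P t i j)"
      using t by (intro sum.cong) (auto simp: joint A'_def B'_def)
    also have "\<dots> = (\<Sum>i\<in>A'. \<P>(\<omega> in M. X 0 \<omega> = i) * (\<Sum>j\<in>B'. P t i j))"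
      by (simp add: sum.cartesian_product sum_distrib_left)
    finally show ?thesis by (simp only: mean_B)
  qed
  have "((\<lambda>t. \<Sum>i\<in>A'. \<P>(\<omega> in M. X 0 \<omega> = i) * semigroup_mean S P (\<lambda>j. of_bool (B j)) i t)
      \<longlongrightarrow> (\<Sum>i\<in>A'. \<P>(\<omega> in M. X 0 \<omega> = i) * c)) at_top"
    using lim[OF P] by (intro tendsto_sum tendsto_mult tendsto_const) (auto simp: A'_def)
  hence "((\<lambda>t. (\<Sum>i\<in>A'. \<P>(\<omega> in M. X 0 \<omega> = i) * semigroup_mean S P (\<lambda>j. of_bool (B j)) i t) /
      \<P>(\<omega> in M. A (X 0 \<omega>))) \<longlongrightarrow> \<P>(\<omega> in M. A (X 0 \<omega>)) * c / \<P>(\<omega> in M. A (X 0 \<omega>))) at_top"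
    unfolding init sum_distrib_right[symmetric] using pos
    by (intro tendsto_divide tendsto_const) (auto simp: init)
  hence "((\<lambda>t. (\<Sum>i\<in>A'. \<P>(\<omega> in M. X 0 \<omega> = i) * semigroup_mean S P (\<lambda>j. of_bool (B j)) i t) /
      \<P>(\<omega> in M. A (X 0 \<omega>))) \<longlongrightarrow> c) at_top"
    using pos by simp
  thus ?thesis
    by (rule Lim_transform_eventually)
       (use eventually_ge_at_top[of "0::real"] in eventually_elim, simp add: cond_prob_def mixture)
qed

end

theorem theorem3:
  fixes N K :: nat
    and M :: "'w measure"
    and \<eta> :: "real \<Rightarrow> 'w \<Rightarrow> nat set"
  assumes "2 \<le> N"
    and "0 < K" and "K \<le> N"
    and "simple_exclusion_process M {0..<N} (star_edges N) (\<lambda>_. 1) \<eta>"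
    and "\<P>(\<omega> in M. card (\<eta> 0 \<omega>) = K) > 0"
  shows
    "((\<lambda>t. \<P>(\<omega> in M. 0 \<in> \<eta> t \<omega> \<bar> card (\<eta> 0 \<omega>) = K)) \<longlongrightarrow>
        (real N - 1) * real K / ((real N - 1) * real K + (real N - real K))) at_top \<and>
     (\<forall>x\<in>{1..<N}.
       ((\<lambda>t. \<P>(\<omega> in M. x \<in> \<eta> t \<omega> \<bar> card (\<eta> 0 \<omega>) = K)) \<longlongrightarrow>
          (real K / (real N - 1)) *
          (((real N - 1) * real K - (real K - 1)) / ((real N - 1) * real K + (real N - real K)))) at_top)"
proof -
  interpret continuous_time_markov_chain M "Pow {0..<N}"
    "exclusion_rate {0..<N} (star_edges N) (\<lambda>_. 1)" \<eta>
    using assms(4) by (simp only: simple_exclusion_process_def)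
  note limit = conditional_limit[where A = "\<lambda>\<xi>. card \<xi> = K", OF _ assms(5)]
  show ?thesis
    by (intro conjI ballI limit star_limit_center star_limit_leaf assms(1-3)) auto
qed

end
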